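(* There is a set $D \subset \mathbb R$, with Lebesgue measure zero, such that the series \[ \sum_{n=1}^{\infty} (-1)^n f(n)\,|\sin(n\pi\alpha)| \] converges for all real $\alpha \notin D$ and all $f \in \mathfrak F$.
   Context: $\mathfrak F$ denotes the class of continuous, decreasing functions $f : [1,\infty) \to \mathbb R$ such that $\lim_{x\to\infty} f(x) = 0$ and $\int_1^\infty f(x)\,dx = \infty$. *)

theory Defs
  imports "HOL-Analysis.Analysis"
begin

(* Functions on [1,oo) are total functions on the reals of which only the values on [1,oo) matter.
   "Decreasing" is taken in the weak sense (non-increasing).  The integral over [1,oo) is the
   improper Riemann integral; f is integrable on each [1,X], being continuous there. *)
definition frakF :: "(real \<Rightarrow> real) set" where
  "frakF = {f. continuous_on {1..} f \<and> antimono_on {1..} f \<and> (f \<longlongrightarrow> 0) at_top \<and>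
               filterlim (\<lambda>X. integral {1..X} f) at_top at_top}"

end

theory Submission
  imports Defs
begin

text \<open>
  Since \<open>f\<close> decreases to zero, Dirichlet's test reduces the claim to a statement about \<open>\<alpha>\<close> alone:
  for almost every \<open>\<alpha>\<close>, the sums of \<open>(-1)\<^sup>n \<bar>sin (n pi \<alpha>)\<bar>\<close> over \<open>n \<le> N\<close> are bounded in \<open>N\<close>. The
  exceptional set is then the same for all \<open>f\<close>.

  The Fourier series (lemma \<open>abs_sin_Fourier_series\<close>)
  \<open>\<bar>sin y\<bar> = 2/pi - (4/pi) (\<Sum>k\<ge>1. cos (2 k y) / (4 k\<^sup>2 - 1))\<close>
  converts these sums into a weighted series of alternating cosine sums, the one of frequency \<open>k\<close>
  being at most \<open>1 / \<bar>cos (pi k \<alpha>)\<bar>\<close> for every \<open>N\<close> (lemma \<open>alternating_cos_sum_bound\<close>).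
  So it suffices that \<open>\<Sum>k. 1 / (k\<^sup>2 \<bar>cos (pi k \<alpha>)\<bar>)\<close> converges for almost every \<open>\<alpha>\<close>, that is, that
  \<open>k \<alpha>\<close> is rarely very close to a half-integer modulo one.

  This last fact (lemma \<open>AE_summable_inverse_cos\<close>) comes from integrating the powers of the terms
  with exponent \<open>3/4\<close>: multiplication by \<open>k\<close> preserves measure modulo one, so the integral over a
  period is a constant times \<open>k powr (-3/2)\<close>.
  The exceptional set consists of the \<open>\<alpha>\<close> for which the series diverges, together with the rational
  numbers, among which are the zeros of the cosines.
\<close>

section \<open>Summation by parts\<close>

text \<open>
  Dirichlet's test, in the form needed below: Abel summation turns the series into one dominated by
  the telescoping series of the increments of \<open>b\<close>.
\<close>

lemma summable_Dirichlet:
  fixes b c :: "nat \<Rightarrow> real"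
  assumes bounded: "\<And>N. \<bar>\<Sum>n<N. c n\<bar> \<le> B"
    and decr: "\<And>n. b (Suc n) \<le> b n" and lim: "b \<longlonglongrightarrow> 0"
  shows "summable (\<lambda>n. c n * b n)"
proof -
  define C where "C = (\<lambda>N. \<Sum>n<N. c n)"
  have parts: "(\<Sum>n<N. c n * b n) = b N * C N + (\<Sum>n<N. (b n - b (Suc n)) * C (Suc n))" for N
    by (induction N) (simp_all add: C_def algebra_simps)
  have "summable (\<lambda>n. (b n - b (Suc n)) * B)"
    using telescope_summable'[OF lim] by (rule summable_mult2)
  then have "summable (\<lambda>n. (b n - b (Suc n)) * C (Suc n))"
  proof (rule summable_comparison_test')
    fix n :: nat
    show "norm ((b n - b (Suc n)) * C (Suc n)) \<le> (b n - b (Suc n)) * B"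
      using decr[of n] bounded[of "Suc n"]
      by (simp only: C_def abs_mult real_norm_def) (intro mult_mono, auto)
  qed
  then have right: "convergent (\<lambda>N. \<Sum>n<N. (b n - b (Suc n)) * C (Suc n))"
    by (simp add: summable_iff_convergent)
  have "(\<lambda>N. b N * C N) \<longlonglongrightarrow> 0"
  proof (rule Lim_null_comparison)
    show "\<forall>\<^sub>F N in sequentially. norm (b N * C N) \<le> \<bar>b N\<bar> * B"
      using bounded by (auto simp: C_def abs_mult intro!: mult_left_mono always_eventually)
    show "(\<lambda>N. \<bar>b N\<bar> * B) \<longlonglongrightarrow> 0"
      using tendsto_mult_left_zero[OF tendsto_rabs_zero[OF lim]] by simp
  qed
  then have "convergent (\<lambda>N. b N * C N)"
    by (rule convergentI)
  from convergent_add[OF this right] show ?thesis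
    by (simp add: summable_iff_convergent parts)
qed

section \<open>The Fourier series of the rectified sine\<close>

lemma abs_cos_pi_int: "\<bar>cos (pi * of_int i)\<bar> = (1::real)"
proof -
  have "(cos (pi * of_int i))\<^sup>2 = (1::real)"
    using sin_cos_squared_add[of "pi * of_int i :: real"] by simp
  then show ?thesis by (simp add: power2_eq_1_iff abs_if split: if_splits)
qed

text \<open>
  The Fourier series of a square wave, at a point where the wave does not jump. At \<open>pi/2\<close> it is
  Leibniz's series for \<open>pi/4\<close>. The derivative of a partial sum is \<open>sin (2 K y) / (2 sin y)\<close>, which
  oscillates so fast that its integral from \<open>pi/2\<close> to \<open>y\<close> is \<open>O(1/K)\<close>; hence the value of the sum
  does not depend on \<open>y\<close>.
\<close>

lemma sum_odd_sines_tendsto: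
  assumes y: "0 < y" "y < pi"
  shows "(\<lambda>K. \<Sum>j<K. sin (real (2*j+1) * y) / real (2*j+1)) \<longlonglongrightarrow> pi/4"
proof -
  define S where "S = (\<lambda>K y. \<Sum>j<K. sin (real (2*j+1) * y) / real (2*j+1))"
  \<comment> \<open>The correction term is the boundary term of an integration by parts of the derivative of
    \<open>S K\<close>; it cancels the oscillating derivative up to a remainder of order \<open>1/K\<close>.\<close>
  define T where "T = (\<lambda>K y. S K y + cos (real (2*K) * y) / (real (4*K) * sin y))"
  define s where "s = sin y"
  define A where "A = closed_segment y (pi/2)"
  have s: "0 < s" using y by (simp add: s_def sin_gt_zero)
  have sin_ge: "s \<le> sin x" if "x \<in> A" for x
  proof (cases "y \<le> pi/2")
    case True
    with that have "y \<le> x" "x \<le> pi/2" by (auto simp: A_def closed_segment_eq_real_ivl)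
    with y show ?thesis unfolding s_def by (intro sin_monotone_2pi_le) auto
  next
    case False
    with that have "x \<le> y" "pi/2 \<le> x" by (auto simp: A_def closed_segment_eq_real_ivl)
    then have "sin (pi - y) \<le> sin (pi - x)" using y by (intro sin_monotone_2pi_le) auto
    then show ?thesis by (simp add: s_def)
  qed
  have sum_cos: "2 * sin x * (\<Sum>j<K. cos (real (2*j+1) * x)) = sin (real (2*K) * x)" for K :: nat and x :: real
  proof (induction K)
    case (Suc K)
    have "2 * sin x * cos (real (2*K+1) * x) = sin (real (2 * Suc K) * x) - sin (real (2*K) * x)"
      using sin_times_cos[of x "real (2*K+1) * x"] sin_minus[of "real (2*K) * x"]
      by (simp add: algebra_simps)
    with Suc show ?case by (simp add: distrib_left)
  qed simp
  have deriv: "(T K has_real_derivative - cos (real (2*K) * x) * cos x / (real (4*K) * (sin x)\<^sup>2)) (at x)"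
    if "x \<in> A" "K > 0" for K x
  proof -
    have sx: "sin x > 0" using sin_ge[OF that(1)] s by simp
    have "(S K has_real_derivative (\<Sum>j<K. cos (real (2*j+1) * x))) (at x)"
      unfolding S_def by (auto intro!: derivative_eq_intros simp del: of_nat_add of_nat_mult)
    moreover have "((\<lambda>x. cos (real (2*K) * x) / (real (4*K) * sin x)) has_real_derivative
        (- sin (real (2*K) * x) / (2 * sin x) - cos (real (2*K) * x) * cos x / (real (4*K) * (sin x)\<^sup>2))) (at x)"
      using sx that(2)
      by (auto intro!: derivative_eq_intros simp: field_simps power2_eq_square)
    ultimately have "(T K has_real_derivative (\<Sum>j<K. cos (real (2*j+1) * x)) +
        (- sin (real (2*K) * x) / (2 * sin x) - cos (real (2*K) * x) * cos x / (real (4*K) * (sin x)\<^sup>2))) (at x)"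
      unfolding T_def by (rule DERIV_add)
    also have "(\<Sum>j<K. cos (real (2*j+1) * x)) = sin (real (2*K) * x) / (2 * sin x)"
      using sum_cos[of x K] sx by (simp add: field_simps)
    finally show ?thesis by simp
  qed
  have T_diff: "\<bar>T K y - T K (pi/2)\<bar> \<le> 1 / (4 * K * s\<^sup>2) * \<bar>y - pi/2\<bar>" if K: "K > 0" for K
  proof -
    have "norm (T K y - T K (pi/2)) \<le> 1 / (4 * K * s\<^sup>2) * norm (y - pi/2)"
    proof (rule field_differentiable_bound[of A])
      show "convex A" by (simp add: A_def)
      show "(T K has_field_derivative - cos (real (2*K) * x) * cos x / (real (4*K) * (sin x)\<^sup>2)) (at x within A)"
        if "x \<in> A" for x
        using deriv[OF that K] by (rule has_field_derivative_at_within)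
      show "norm (- cos (real (2*K) * x) * cos x / (real (4*K) * (sin x)\<^sup>2)) \<le> 1 / (4 * K * s\<^sup>2)"
        if "x \<in> A" for x
      proof -
        have "\<bar>cos (real (2*K) * x)\<bar> * \<bar>cos x\<bar> \<le> 1 * 1"
          by (intro mult_mono) auto
        moreover have "s\<^sup>2 \<le> (sin x)\<^sup>2" using sin_ge[OF that] s by (intro power_mono) auto
        ultimately show ?thesis
          using s K unfolding real_norm_def abs_divide abs_mult abs_minus_cancel
          by (intro frac_le) auto
      qed
    qed (auto simp: A_def)
    then show ?thesis by simp
  qed
  define E where "E = 1 / (4 * s\<^sup>2) * \<bar>y - pi/2\<bar> + 1 / (4 * s) + 1/4"
  have S_diff: "\<bar>S K y - S K (pi/2)\<bar> \<le> E * inverse (real K)" if K: "K > 0" for K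
  proof -
    have a: "\<bar>cos (real (2*K) * y) / (real (4*K) * s)\<bar> \<le> 1 / (4 * K * s)"
      using s K unfolding abs_divide by (intro frac_le) auto
    have b: "\<bar>cos (real (2*K) * (pi/2)) / real (4*K)\<bar> \<le> 1 / (4 * K)"
      using K unfolding abs_divide by (intro frac_le) auto
    have "S K y - S K (pi/2) = (T K y - T K (pi/2)) - cos (real (2*K) * y) / (real (4*K) * s)
       + cos (real (2*K) * (pi/2)) / real (4*K)"
      by (simp add: T_def s_def)
    then have "\<bar>S K y - S K (pi/2)\<bar> \<le> 1 / (4 * K * s\<^sup>2) * \<bar>y - pi/2\<bar> + 1 / (4 * K * s) + 1 / (4 * K)"
      using T_diff[OF K] a b by linarith
    also have "\<dots> = E * inverse (real K)"
      using K s by (simp add: E_def field_simps)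
    finally show ?thesis .
  qed
  have "(\<lambda>K. S K y - S K (pi/2)) \<longlonglongrightarrow> 0"
  proof (rule Lim_null_comparison)
    show "\<forall>\<^sub>F K in sequentially. norm (S K y - S K (pi/2)) \<le> E * inverse (real K)"
      using eventually_gt_at_top[of 0] by eventually_elim (use S_diff in simp)
    show "(\<lambda>K. E * inverse (real K)) \<longlonglongrightarrow> 0"
      by (rule tendsto_mult_right_zero[OF lim_inverse_n])
  qed
  moreover have "(\<lambda>K. S K (pi/2)) \<longlonglongrightarrow> pi/4"
  proof -
    have "sin (real (2*j+1) * (pi/2)) = (-1)^j" for j
      by (simp add: distrib_left distrib_right sin_add mult.commute)
    then have "S K (pi/2) = (\<Sum>k<K. (-1)^k * 1 / real (k * 2 + 1))" for K
      by (simp add: S_def mult.commute)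
    moreover have "summable (\<lambda>k. (-1)^k * 1 / real (k * 2 + 1))"
      using summable_arctan_series[of 1] by simp
    then have "(\<lambda>K. \<Sum>k<K. (-1)^k * 1 / real (k * 2 + 1)) \<longlonglongrightarrow> pi/4"
      unfolding pi_series by (rule summable_LIMSEQ)
    ultimately show ?thesis by simp
  qed
  ultimately have "(\<lambda>K. (S K y - S K (pi/2)) + S K (pi/2)) \<longlonglongrightarrow> 0 + pi/4"
    by (rule tendsto_add)
  then show ?thesis by (simp add: S_def)
qed

text \<open>
  Splitting \<open>2 / (4k\<^sup>2 - 1) = 1 / (2k - 1) - 1 / (2k + 1)\<close> and summing by parts reduces this series
  to \<open>1/2 - sin y\<close> times the square-wave series, which has the value \<open>pi/4\<close> on \<open>(0, pi)\<close>; both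
  sides have period \<open>pi\<close>. What matters later is that the coefficients are \<open>O(1/k\<^sup>2)\<close>.
\<close>

lemma abs_sin_Fourier_series:
  "(\<lambda>j. cos (2 * real (Suc j) * y) / (4 * (real (Suc j))\<^sup>2 - 1)) sums (1/2 - pi/4 * \<bar>sin y\<bar>)"
proof -
  have upto_pi: "(\<lambda>j. cos (2 * real (Suc j) * y) / (4 * (real (Suc j))\<^sup>2 - 1)) sums (1/2 - pi/4 * sin y)"
    if y: "0 \<le> y" "y < pi" for y
  proof -
    define S where "S = (\<lambda>K. \<Sum>j<K. sin (real (2*j+1) * y) / real (2*j+1))"
    have partial: "(\<Sum>j<K. cos (2 * real (Suc j) * y) / (4 * (real (Suc j))\<^sup>2 - 1))
        = 1/2 - sin y * S K - cos (2 * real K * y) / (2 * real (2*K+1))" for K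
    proof (induction K)
      case (Suc K)
      define c where "c = cos (2 * real (Suc K) * y)"
      have split: "sin y * sin (real (2*K+1) * y) = (cos (2 * real K * y) - c) / 2"
        using sin_times_sin[of y "real (2*K+1) * y"] cos_minus[of "2 * real K * y"]
        by (simp add: c_def algebra_simps)
      have "4 * (real (Suc K))\<^sup>2 - 1 = real (2*K+1) * real (2*K+3)"
        by (simp add: power2_eq_square algebra_simps)
      then have "c / (4 * (real (Suc K))\<^sup>2 - 1) = c / 2 * (1 / real (2*K+1) - 1 / real (2*K+3))"
        by (simp add: field_simps)
      moreover have "sin y * S (Suc K) = sin y * S K + (cos (2 * real K * y) - c) / 2 / real (2*K+1)"
        unfolding S_def split[symmetric] by (simp add: algebra_simps)
      moreover have "2 * Suc K + 1 = 2*K+3" by simp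
      ultimately show ?case
        unfolding sum.lessThan_Suc Suc.IH c_def[symmetric]
        by (simp only: ) (simp add: diff_divide_distrib right_diff_distrib)
    qed (simp add: S_def)
    have "(\<lambda>K. sin y * S K) \<longlonglongrightarrow> pi/4 * sin y"
    proof (cases "y = 0")
      case False
      with y tendsto_mult_left[OF sum_odd_sines_tendsto[of y], of "sin y"] show ?thesis
        by (simp add: S_def mult.commute)
    qed simp
    moreover have "(\<lambda>K. cos (2 * real K * y) / (2 * real (2*K+1))) \<longlonglongrightarrow> 0"
    proof (rule Lim_null_comparison)
      show "\<forall>\<^sub>F K in sequentially. norm (cos (2 * real K * y) / (2 * real (2*K+1))) \<le> inverse (real K)"
        using eventually_gt_at_top[of 0]
      proof eventually_elim
        case (elim K)
        have "\<bar>cos (2 * real K * y)\<bar> / (2 * real (2*K+1)) \<le> 1 / real K"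
          using elim by (intro frac_le) auto
        then show ?case by (simp add: inverse_eq_divide)
      qed
    qed (rule lim_inverse_n)
    ultimately have "(\<lambda>K. 1/2 - sin y * S K - cos (2 * real K * y) / (2 * real (2*K+1)))
        \<longlonglongrightarrow> 1/2 - pi/4 * sin y - 0"
      by (intro tendsto_diff tendsto_const)
    then show ?thesis
      unfolding sums_def partial by simp
  qed
  define m where "m = \<lfloor>y / pi\<rfloor>"
  define z where "z = y - pi * of_int m"
  have z: "0 \<le> z" "z < pi"
    using floor_divide_lower[of pi y] floor_divide_upper[of pi y]
    by (auto simp: z_def m_def algebra_simps)
  have y: "y = z + pi * of_int m" by (simp add: z_def)
  have "cos (2 * real (Suc j) * y) = cos (2 * real (Suc j) * z)" for j
  proof -
    have "2 * real (Suc j) * y = 2 * real (Suc j) * z + 2 * pi * of_int (int (Suc j) * m)"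
      by (simp add: y algebra_simps)
    then show ?thesis by (simp only: cos_add cos_int_2pin sin_int_2pin)
  qed
  moreover have "\<bar>sin y\<bar> = sin z"
    using sin_ge_zero[of z] z by (simp add: y sin_add abs_mult abs_cos_pi_int)
  ultimately show ?thesis using upto_pi[OF z] by simp
qed

section \<open>Alternating sums of cosines and of rectified sines\<close>

text \<open>
  Multiplication by \<open>2 cos (t/2)\<close> makes the sum telescope: the sign \<open>(-1)\<^sup>n\<close> shifts the frequency
  \<open>t\<close> by \<open>pi\<close>, and therefore the usual denominator \<open>sin (t/2)\<close> of the Dirichlet kernel becomes a
  cosine.
\<close>

lemma alternating_cos_sum_bound:
  assumes "cos (t/2) \<noteq> 0"
  shows "\<bar>\<Sum>n<N. (-1) ^ Suc n * cos (real (Suc n) * t)\<bar> \<le> 1 / \<bar>cos (t/2)\<bar>"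
proof -
  have tele: "2 * cos (t/2) * (\<Sum>n<N. (-1) ^ Suc n * cos (real (Suc n) * t))
      = (-1) ^ N * cos ((real N + 1/2) * t) - cos (t/2)"
  proof (induction N)
    case (Suc N)
    have "2 * cos (t/2) * cos (real (Suc N) * t) = cos ((real N + 1/2) * t) + cos ((real (Suc N) + 1/2) * t)"
      using cos_times_cos[of "real (Suc N) * t" "t/2"] by (simp add: algebra_simps)
    then have "2 * cos (t/2) * ((-1) ^ Suc N * cos (real (Suc N) * t))
        = (-1) ^ Suc N * (cos ((real N + 1/2) * t) + cos ((real (Suc N) + 1/2) * t))"
      by (metis mult.left_commute)
    then show ?case
      unfolding sum.lessThan_Suc distrib_left Suc.IH by (simp add: distrib_left)
  qed simp
  have "\<bar>(-1) ^ N * cos ((real N + 1/2) * t) - cos (t/2)\<bar> \<le> \<bar>(-1) ^ N * cos ((real N + 1/2) * t)\<bar> + \<bar>cos (t/2)\<bar>"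
    by (rule abs_triangle_ineq4)
  also have "\<dots> \<le> 1 + 1"
    by (intro add_mono) (auto simp: abs_mult power_abs)
  finally have "2 * \<bar>cos (t/2)\<bar> * \<bar>\<Sum>n<N. (-1) ^ Suc n * cos (real (Suc n) * t)\<bar> \<le> 2"
    unfolding tele[symmetric] abs_mult by simp
  with assms show ?thesis by (simp add: field_simps)
qed

lemma cos_pi_multiple_irrational:
  assumes "\<alpha> \<notin> \<rat>"
  shows "cos (pi * (real (Suc j) * \<alpha>)) \<noteq> 0"
proof
  assume "cos (pi * (real (Suc j) * \<alpha>)) = 0"
  then obtain n :: int where "pi * (real (Suc j) * \<alpha>) = n * pi + pi/2"
    unfolding cos_zero_iff_int2 by blast
  then have "pi * (real (Suc j) * \<alpha>) = pi * (of_int n + 1/2)"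
    by (simp add: algebra_simps)
  then have "real (Suc j) * \<alpha> = of_int n + 1/2"
    by (simp only: mult_cancel_left) simp
  then have "\<alpha> = (of_int n + 1/2) / real (Suc j)"
    by (simp add: field_simps del: of_nat_Suc)
  also have "\<dots> \<in> \<rat>" by (intro Rats_divide Rats_add Rats_of_int Rats_of_nat Rats_1 Rats_number_of)
  finally show False using assms by simp
qed

text \<open>
  Expanding each \<open>\<bar>sin\<bar>\<close> in its Fourier series and exchanging the finite sum with the series leaves,
  at frequency \<open>k\<close>, an alternating cosine sum of size at most \<open>1 / \<bar>cos (pi k \<alpha>)\<bar>\<close> with a weight of
  order \<open>1/k\<^sup>2\<close>. The constant Fourier coefficient contributes an alternating sum of ones.

  Irrationality guarantees that no cosine vanishes. Summability alone would not, because the term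
  with a vanishing cosine is \<open>1 / 0 = 0\<close>.
\<close>

lemma alternating_abs_sin_sum_bound:
  fixes \<alpha> :: real
  assumes irrational: "\<alpha> \<notin> \<rat>"
    and summ: "summable (\<lambda>j. 1 / ((real (Suc j))\<^sup>2 * \<bar>cos (pi * (real (Suc j) * \<alpha>))\<bar>))"
  shows "\<exists>B. \<forall>N. \<bar>\<Sum>n<N. (-1) ^ Suc n * \<bar>sin (real (Suc n) * pi * \<alpha>)\<bar>\<bar> \<le> B"
proof -
  define w where "w = (\<lambda>j. 4 * (real (Suc j))\<^sup>2 - 1)"
  define d where "d = (\<lambda>j. 1 / ((real (Suc j))\<^sup>2 * \<bar>cos (pi * (real (Suc j) * \<alpha>))\<bar>))"
  have w: "(real (Suc j))\<^sup>2 \<le> w j" for j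
  proof -
    have "1 \<le> (real (Suc j))\<^sup>2" by (rule one_le_power) simp
    then show ?thesis unfolding w_def by linarith
  qed
  have "\<bar>\<Sum>n<N. (-1) ^ Suc n * \<bar>sin (real (Suc n) * pi * \<alpha>)\<bar>\<bar> \<le> 4/pi * (1/2 + suminf d)" for N
  proof -
    define F where "F = (\<lambda>j. \<Sum>n<N. (-1) ^ Suc n * cos (real (Suc n) * (2 * pi * (real (Suc j) * \<alpha>))))"
    have F: "\<bar>F j / w j\<bar> \<le> d j" for j
    proof -
      have "\<bar>F j\<bar> \<le> 1 / \<bar>cos (pi * (real (Suc j) * \<alpha>))\<bar>"
        using alternating_cos_sum_bound[of "2 * pi * (real (Suc j) * \<alpha>)" N] cos_pi_multiple_irrational[OF irrational, of j]
        by (simp add: F_def mult.assoc del: of_nat_Suc)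
      then have "\<bar>F j\<bar> / w j \<le> (1 / \<bar>cos (pi * (real (Suc j) * \<alpha>))\<bar>) / (real (Suc j))\<^sup>2"
        using w[of j] by (intro frac_le) (auto simp del: of_nat_Suc)
      moreover have "0 \<le> w j" using w[of j] by (rule order_trans[rotated]) simp
      ultimately show ?thesis by (simp add: d_def mult.commute abs_divide del: of_nat_Suc)
    qed
    have "(\<lambda>j. \<Sum>n<N. (-1) ^ Suc n * (cos (2 * real (Suc j) * (real (Suc n) * pi * \<alpha>)) / w j)) sums
        (\<Sum>n<N. (-1) ^ Suc n * (1/2 - pi/4 * \<bar>sin (real (Suc n) * pi * \<alpha>)\<bar>))"
      unfolding w_def by (intro sums_sum sums_mult abs_sin_Fourier_series)
    also have "(\<lambda>j. \<Sum>n<N. (-1) ^ Suc n * (cos (2 * real (Suc j) * (real (Suc n) * pi * \<alpha>)) / w j)) = (\<lambda>j. F j / w j)"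
      by (simp add: F_def sum_divide_distrib mult_ac del: of_nat_Suc power_Suc)
    finally have Fourier: "(\<lambda>j. F j / w j) sums
        (\<Sum>n<N. (-1) ^ Suc n * (1/2 - pi/4 * \<bar>sin (real (Suc n) * pi * \<alpha>)\<bar>))" .
    have "\<bar>\<Sum>j. F j / w j\<bar> \<le> suminf d"
    proof -
      have "summable (\<lambda>j. \<bar>F j / w j\<bar>)"
        by (rule summable_comparison_test'[of d 0]) (use summ F in \<open>auto simp: d_def\<close>)
      then have "\<bar>\<Sum>j. F j / w j\<bar> \<le> (\<Sum>j. \<bar>F j / w j\<bar>)" by (rule summable_rabs)
      also have "\<dots> \<le> suminf d"
        using F \<open>summable (\<lambda>j. \<bar>F j / w j\<bar>)\<close> summ unfolding d_def by (intro suminf_le) auto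
      finally show ?thesis .
    qed
    moreover have "\<bar>\<Sum>n<N. (-1) ^ Suc n * (1/2::real)\<bar> \<le> 1/2"
    proof -
      have "(\<Sum>n<N. (-1) ^ Suc n * (1/2::real)) = (if even N then 0 else -1/2)"
        by (induction N) auto
      then show ?thesis by simp
    qed
    moreover have "pi/4 * (\<Sum>n<N. (-1) ^ Suc n * \<bar>sin (real (Suc n) * pi * \<alpha>)\<bar>)
        = (\<Sum>n<N. (-1) ^ Suc n * (1/2)) - (\<Sum>j. F j / w j)"
      unfolding sums_unique[OF Fourier, symmetric] sum_subtractf[symmetric] sum_distrib_left
      by (intro sum.cong) (simp_all add: algebra_simps del: of_nat_Suc power_Suc)
    ultimately have "\<bar>pi/4 * (\<Sum>n<N. (-1) ^ Suc n * \<bar>sin (real (Suc n) * pi * \<alpha>)\<bar>)\<bar> \<le> 1/2 + suminf d"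
      by linarith
    then have "pi/4 * \<bar>\<Sum>n<N. (-1) ^ Suc n * \<bar>sin (real (Suc n) * pi * \<alpha>)\<bar>\<bar> \<le> 1/2 + suminf d"
      by (simp add: abs_mult del: of_nat_Suc power_Suc)
    then show ?thesis by (simp add: field_simps del: of_nat_Suc power_Suc)
  qed
  then show ?thesis by blast
qed

section \<open>Summability for almost every number\<close>

lemma nn_integral_periodic_interval:
  fixes g :: "real \<Rightarrow> ennreal" and m :: int
  assumes [measurable]: "g \<in> borel_measurable borel"
    and periodic: "\<And>x (i::int). g (x + of_int i) = g x"
  shows "(\<integral>\<^sup>+x. g x * indicator {of_int m..<of_int m + 1} x \<partial>lborel) = (\<integral>\<^sup>+x. g x * indicator {0..<1} x \<partial>lborel)"
proof -
  have "(\<integral>\<^sup>+x. g x * indicator {of_int m..<of_int m + 1} x \<partial>lborel)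
      = (\<integral>\<^sup>+x. g (of_int m + 1 * x) * indicator {of_int m..<of_int m + 1} (of_int m + 1 * x) \<partial>lborel)"
    by (subst nn_integral_real_affine[where c = 1 and t = "of_int m"]) auto
  also have "\<dots> = (\<integral>\<^sup>+x. g x * indicator {0..<1} x \<partial>lborel)"
    using periodic[of _ m] by (intro nn_integral_cong) (auto simp: indicator_def add.commute)
  finally show ?thesis .
qed

text \<open>
  The map \<open>x \<mapsto> k x\<close> preserves Lebesgue measure modulo one: stretching a unit interval by \<open>k\<close>
  gives \<open>k\<close> full periods of \<open>g\<close>, and the factor \<open>1/k\<close> from the change of variables compensates this.
\<close>

lemma nn_integral_periodic_dilate:
  fixes g :: "real \<Rightarrow> ennreal" and k :: nat and m :: int
  assumes [measurable]: "g \<in> borel_measurable borel"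
    and periodic: "\<And>x (i::int). g (x + of_int i) = g x" and k: "k > 0"
  shows "(\<integral>\<^sup>+x. g (real k * x) * indicator {of_int m..<of_int m + 1} x \<partial>lborel)
       = (\<integral>\<^sup>+x. g x * indicator {0..<1} x \<partial>lborel)"
proof -
  define I where "I = (\<integral>\<^sup>+x. g x * indicator {0..<1} x \<partial>lborel)"
  have periods: "(\<integral>\<^sup>+x. g x * indicator {0..<real n} x \<partial>lborel) = of_nat n * I" for n
  proof (induction n)
    case (Suc n)
    have "(\<integral>\<^sup>+x. g x * indicator {0..<real (Suc n)} x \<partial>lborel)
        = (\<integral>\<^sup>+x. g x * indicator {0..<real n} x + g x * indicator {of_int (int n)..<of_int (int n) + 1} x \<partial>lborel)"
      by (intro nn_integral_cong) (auto simp: indicator_def)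
    also have "\<dots> = of_nat n * I + I"
      using nn_integral_periodic_interval[OF assms(1,2), of "int n"]
      by (subst nn_integral_add) (auto simp: Suc I_def)
    finally show ?case by (simp add: distrib_right add.commute)
  qed simp
  have scale_in: "real k * x < real k \<longleftrightarrow> x < 1" "0 \<le> real k * x \<longleftrightarrow> 0 \<le> x" for x
    using k by (auto simp: zero_le_mult_iff)
  have "of_nat k * I = ennreal \<bar>real k\<bar> * (\<integral>\<^sup>+x. g (0 + real k * x) * indicator {0..<real k} (0 + real k * x) \<partial>lborel)"
    unfolding periods[symmetric] using k by (subst nn_integral_real_affine[where c = "real k" and t = 0]) auto
  also have "\<dots> = of_nat k * (\<integral>\<^sup>+x. g (real k * x) * indicator {0..<1} x \<partial>lborel)"
    by (simp add: indicator_def scale_in ennreal_of_nat_eq_real_of_nat)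
  finally have "I = (\<integral>\<^sup>+x. g (real k * x) * indicator {0..<1} x \<partial>lborel)"
    using k by (simp add: ennreal_mult_cancel_left)
  moreover have "g (real k * (x + of_int i)) = g (real k * x)" for x and i :: int
    using periodic[of "real k * x" "int k * i"] by (simp add: distrib_left)
  ultimately show ?thesis
    by (subst nn_integral_periodic_interval[where g = "\<lambda>x. g (real k * x)"]) (auto simp: I_def)
qed

text \<open>
  By concavity, the graph of the cosine lies above its chord on each half of the interval. So the
  zero of the cosine at \<open>1/2\<close> is simple.
\<close>

lemma abs_cos_ge_dist_half:
  assumes x: "0 \<le> x" "x \<le> 1"
  shows "\<bar>1 - 2 * x\<bar> \<le> \<bar>cos (pi * x)\<bar>"
proof -
  have half: "1 - 2 * u \<le> cos (pi * u)" if u: "0 \<le> u" "u \<le> 1/2" for u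
  proof -
    have "concave_on {0..1/2} (\<lambda>u. cos (pi * u))"
    proof (rule f''_le0_imp_concave)
      fix x :: real assume x: "x \<in> {0..1/2}"
      show "((\<lambda>u. cos (pi * u)) has_real_derivative - (pi * sin (pi * x))) (at x)"
        by (auto intro!: derivative_eq_intros)
      show "((\<lambda>u. - (pi * sin (pi * u))) has_real_derivative - (pi\<^sup>2 * cos (pi * x))) (at x)"
        by (auto intro!: derivative_eq_intros simp: power2_eq_square)
      have "0 \<le> pi * x" "pi * x \<le> pi * (1/2)"
        using x by (auto intro!: mult_left_mono)
      then have "cos (pi * x) \<ge> 0"
        using pi_gt_zero by (intro cos_ge_zero) linarith+
      then show "- (pi\<^sup>2 * cos (pi * x)) \<le> 0" by simp
    qed simp
    from concave_onD_Icc'[OF this, of u] u show ?thesis by simp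
  qed
  show ?thesis
  proof (cases "x \<le> 1/2")
    case True
    with half[of x] x show ?thesis by simp
  next
    case False
    with half[of "1 - x"] x show ?thesis by (simp add: right_diff_distrib)
  qed
qed

text \<open>
  Near the simple zero the integrand behaves like \<open>\<bar>u\<bar>\<close> to the power \<open>-3/4\<close>, and this exponent
  is greater than \<open>-1\<close>.
\<close>

lemma nn_integral_abs_cos_powr_finite:
  "(\<integral>\<^sup>+x. ennreal (\<bar>cos (pi * x)\<bar> powr (-3/4)) * indicator {0..<1} x \<partial>lborel) < \<infinity>"
proof -
  define J where "J = (\<integral>\<^sup>+u. indicator {0..1} u * ennreal (u powr (-3/4)) \<partial>lborel)"
  have J: "J < \<infinity>"
  proof -
    have "J = (\<integral>\<^sup>+u. ennreal (indicator {0..1} u * (u powr (-3/4))) \<partial>lborel)"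
      unfolding J_def by (intro nn_integral_cong) (auto simp: indicator_def)
    also have "\<dots> = ennreal (1 powr (-3/4 + 1) / (-3/4 + 1))"
      using has_integral_powr_from_0[of "-3/4" 1]
      by (intro nn_integral_has_integral_lebesgue) simp_all
    finally show ?thesis by simp
  qed
  define h where "h = (\<lambda>u::real. ennreal (\<bar>u\<bar> powr (-3/4)) * indicator {-1..1} u)"
  have [measurable]: "h \<in> borel_measurable borel" by (simp add: h_def)
  have "(\<integral>\<^sup>+x. ennreal (\<bar>cos (pi * x)\<bar> powr (-3/4)) * indicator {0..<1} x \<partial>lborel) \<le> (\<integral>\<^sup>+x. h (1 + (-2) * x) \<partial>lborel)"
  proof (rule nn_integral_mono_AE)
    \<comment> \<open>The point \<open>1/2\<close> is removed because \<open>0 powr (-3/4) = 0\<close> breaks the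
      monotonicity of the power there.\<close>
    have "AE x in lborel. x \<noteq> (1/2::real)" by (rule AE_lborel_singleton)
    then show "AE x in lborel. ennreal (\<bar>cos (pi * x)\<bar> powr (-3/4)) * indicator {0..<1} x \<le> h (1 + (-2) * x)"
    proof eventually_elim
      case (elim x)
      then show ?case
        using abs_cos_ge_dist_half[of x]
        by (auto simp: h_def indicator_def intro!: ennreal_leI powr_mono2')
    qed
  qed
  also have "\<dots> \<le> 2 * (\<integral>\<^sup>+x. h (1 + (-2) * x) \<partial>lborel)"
    using mult_right_mono[of 1 2 "\<integral>\<^sup>+x. h (1 + (-2) * x) \<partial>lborel"] by (simp only: mult_1_left) simp
  also have "\<dots> = (\<integral>\<^sup>+u. h u \<partial>lborel)"
    using nn_integral_real_affine[of h "-2" 1] by simp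
  also have "\<dots> \<le> (\<integral>\<^sup>+u. indicator {0..1} u * ennreal (u powr (-3/4))
        + indicator {0..1} (0 + (-1) * u) * ennreal ((0 + (-1) * u) powr (-3/4)) \<partial>lborel)"
    by (intro nn_integral_mono) (auto simp: h_def indicator_def)
  also have "\<dots> = J + J"
  proof -
    have "J = (\<integral>\<^sup>+u. indicator {0..1} (0 + (-1) * u) * ennreal ((0 + (-1) * u) powr (-3/4)) \<partial>lborel)"
      using nn_integral_real_affine[of "\<lambda>u. indicator {0..1} u * ennreal (u powr (-3/4))" "-1" 0]
      by (simp add: J_def)
    then show ?thesis by (subst nn_integral_add) (simp_all add: J_def)
  qed
  also have "\<dots> < \<infinity>" using J by simp
  finally show ?thesis .
qed

text \<open>
  The function \<open>1 / \<bar>cos\<bar>\<close> is not integrable, so the series cannot be integrated term by term. Its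
  terms raised to the power \<open>3/4\<close> can: each power of a cosine has the same finite integral over a
  period, and the weights \<open>k powr (-3/2)\<close> are still summable. Hence the series of the powers converges
  almost everywhere. Its terms are eventually less than 1, where a number is at most its power
  with exponent \<open>3/4\<close>, and the original series converges as well. Any exponent strictly between
  \<open>1/2\<close> and \<open>1\<close> would serve.
\<close>

lemma AE_summable_inverse_cos:
  "AE \<alpha> in lborel. summable (\<lambda>j. 1 / ((real (Suc j))\<^sup>2 * \<bar>cos (pi * (real (Suc j) * \<alpha>))\<bar>))"
proof -
  define g where "g = (\<lambda>x. ennreal (\<bar>cos (pi * x)\<bar> powr (-3/4)))"
  have [measurable]: "g \<in> borel_measurable borel" by (simp add: g_def)
  have periodic: "g (x + of_int i) = g x" for x and i :: int
    by (simp add: g_def distrib_left cos_add abs_mult abs_cos_pi_int)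
  define b where "b = (\<lambda>\<alpha> j. real (Suc j) powr (-3/2) * \<bar>cos (pi * (real (Suc j) * \<alpha>))\<bar> powr (-3/4))"
  have unit: "AE \<alpha> in lborel. (\<Sum>j. ennreal (b \<alpha> j) * indicator {of_int m..<of_int m + 1} \<alpha>) \<noteq> \<infinity>" for m :: int
  proof (rule nn_integral_PInf_AE)
    define I where "I = (\<integral>\<^sup>+x. g x * indicator {0..<1} x \<partial>lborel)"
    have I: "I < \<infinity>" using nn_integral_abs_cos_powr_finite by (simp add: I_def g_def)
    have "(\<integral>\<^sup>+\<alpha>. ennreal (b \<alpha> j) * indicator {of_int m..<of_int m + 1} \<alpha> \<partial>lborel)
        = ennreal (real (Suc j) powr (-3/2)) * I" for j
    proof -
      have "(\<integral>\<^sup>+\<alpha>. ennreal (b \<alpha> j) * indicator {of_int m..<of_int m + 1} \<alpha> \<partial>lborel)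
        = (\<integral>\<^sup>+\<alpha>. ennreal (real (Suc j) powr (-3/2)) * (g (real (Suc j) * \<alpha>) * indicator {of_int m..<of_int m + 1} \<alpha>) \<partial>lborel)"
        by (simp add: b_def g_def ennreal_mult' mult.assoc del: of_nat_Suc)
      also have "\<dots> = ennreal (real (Suc j) powr (-3/2)) * I"
        unfolding I_def by (subst nn_integral_cmult, measurable) (subst nn_integral_periodic_dilate, auto simp: periodic)
      finally show ?thesis .
    qed
    then have "(\<integral>\<^sup>+\<alpha>. (\<Sum>j. ennreal (b \<alpha> j) * indicator {of_int m..<of_int m + 1} \<alpha>) \<partial>lborel)
        = (\<Sum>j. ennreal (real (Suc j) powr (-3/2)) * I)"
      by (subst nn_integral_suminf) (auto simp: b_def)
    also have "\<dots> = (\<Sum>j. ennreal (real (Suc j) powr (-3/2))) * I"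
      by simp
    also have "\<dots> < \<infinity>"
    proof -
      have "summable (\<lambda>j. real (Suc j) powr (-3/2))"
        by (subst summable_Suc_iff) (simp add: summable_real_powr_iff)
      then have "(\<Sum>j. ennreal (real (Suc j) powr (-3/2))) \<noteq> top"
        by (rule ennreal_suminf_neq_top) simp
      with I show ?thesis
        unfolding infinity_ennreal_def ennreal_mult_less_top by (blast intro: top.not_eq_extremum[THEN iffD1])
    qed
    finally show "(\<integral>\<^sup>+\<alpha>. (\<Sum>j. ennreal (b \<alpha> j) * indicator {of_int m..<of_int m + 1} \<alpha>) \<partial>lborel) \<noteq> \<infinity>"
      by simp
  qed (auto simp: b_def)
  have "AE \<alpha> in lborel. \<forall>m::int. (\<Sum>j. ennreal (b \<alpha> j) * indicator {of_int m..<of_int m + 1} \<alpha>) \<noteq> \<infinity>"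
    using unit by (simp add: AE_all_countable)
  then show ?thesis
  proof eventually_elim
    case (elim \<alpha>)
    have "\<alpha> \<in> {of_int \<lfloor>\<alpha>\<rfloor>..<of_int \<lfloor>\<alpha>\<rfloor> + 1}" using floor_correct[of \<alpha>] by auto
    with elim[rule_format, of "\<lfloor>\<alpha>\<rfloor>"] have "(\<Sum>j. ennreal (b \<alpha> j)) \<noteq> top" by simp
    then have sum_b: "summable (b \<alpha>)"
      by (intro summable_suminf_not_top) (auto simp: b_def)
    then have "b \<alpha> \<longlonglongrightarrow> 0" by (rule summable_LIMSEQ_zero)
    then have "\<forall>\<^sub>F j in sequentially. b \<alpha> j < 1" by (rule order_tendstoD) simp
    then have "\<forall>\<^sub>F j in sequentially. norm (1 / ((real (Suc j))\<^sup>2 * \<bar>cos (pi * (real (Suc j) * \<alpha>))\<bar>)) \<le> b \<alpha> j"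
    proof eventually_elim
      case (elim j)
      define a where "a = 1 / ((real (Suc j))\<^sup>2 * \<bar>cos (pi * (real (Suc j) * \<alpha>))\<bar>)"
      have a0: "a \<ge> 0" by (simp add: a_def)
      have "a powr (3/4) = b \<alpha> j"
      proof -
        have "((real (Suc j))\<^sup>2) powr (3/4) = real (Suc j) powr (3/2)"
          by (subst powr_powr[symmetric, of _ 2 "3/4", simplified]) auto
        then have "a powr (3/4) = 1 / (real (Suc j) powr (3/2) * \<bar>cos (pi * (real (Suc j) * \<alpha>))\<bar> powr (3/4))"
          by (simp only: a_def powr_divide powr_mult powr_one_eq_one)
        also have "\<dots> = b \<alpha> j"
          using powr_minus_divide[of "real (Suc j)" "3/2"]
            powr_minus_divide[of "\<bar>cos (pi * (real (Suc j) * \<alpha>))\<bar>" "3/4"]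
          by (simp only: b_def minus_divide_left times_divide_times_eq mult_1_left)
        finally show ?thesis .
      qed
      moreover have "a \<le> a powr (3/4)" if "a powr (3/4) < 1"
      proof (cases "a = 0")
        case False
        with a0 have "a > 0" by simp
        moreover have "a < 1" using that ge_one_powr_ge_zero[of a "3/4"] by linarith
        ultimately show ?thesis using powr_mono'[of "3/4" 1 a] by simp
      qed simp
      ultimately show ?case using elim a0 by (simp add: a_def)
    qed
    then show ?case using sum_b by (rule summable_comparison_test_ev)
  qed
qed

section \<open>Convergence outside a null set\<close>

theorem corollary3:
  shows "\<exists>D :: real set. D \<in> null_sets lebesgue \<and>
    (\<forall>\<alpha>. \<alpha> \<notin> D \<longrightarrow> (\<forall>f \<in> frakF.
       summable (\<lambda>n::nat. (-1) ^ Suc n * f (real (Suc n)) * \<bar>sin (real (Suc n) * pi * \<alpha>)\<bar>)))"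
proof -
  have "AE \<alpha> in lborel. \<alpha> \<notin> (\<rat> :: real set)"
    using countable_rat by (intro AE_not_in countable_imp_null_set_lborel)
  with AE_summable_inverse_cos have "AE \<alpha> in lborel. \<alpha> \<notin> \<rat> \<and>
      summable (\<lambda>j. 1 / ((real (Suc j))\<^sup>2 * \<bar>cos (pi * (real (Suc j) * \<alpha>))\<bar>))"
    by eventually_elim blast
  then obtain D where D: "D \<in> null_sets lborel"
    and good: "{\<alpha>. \<not> (\<alpha> \<notin> \<rat> \<and>
      summable (\<lambda>j. 1 / ((real (Suc j))\<^sup>2 * \<bar>cos (pi * (real (Suc j) * \<alpha>))\<bar>)))} \<subseteq> D"
    unfolding eventually_ae_filter by auto
  have "summable (\<lambda>n::nat. (-1) ^ Suc n * f (real (Suc n)) * \<bar>sin (real (Suc n) * pi * \<alpha>)\<bar>)"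
    if "\<alpha> \<notin> D" and f: "f \<in> frakF" for \<alpha> f
  proof -
    from that(1) good have "\<alpha> \<notin> \<rat>"
      "summable (\<lambda>j. 1 / ((real (Suc j))\<^sup>2 * \<bar>cos (pi * (real (Suc j) * \<alpha>))\<bar>))" by auto
    from alternating_abs_sin_sum_bound[OF this] obtain B where
      B: "\<bar>\<Sum>n<N. (-1) ^ Suc n * \<bar>sin (real (Suc n) * pi * \<alpha>)\<bar>\<bar> \<le> B" for N by blast
    have "f (real (Suc (Suc n))) \<le> f (real (Suc n))" for n
      using f by (auto simp: frakF_def intro: monotone_onD[of "{1..}" "(\<le>)" "(\<ge>)" f])
    moreover have "(\<lambda>n. f (real (Suc n))) \<longlonglongrightarrow> 0"
    proof (rule filterlim_compose[of f])
      show "(f \<longlongrightarrow> 0) at_top" using f by (simp add: frakF_def)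
      show "filterlim (\<lambda>n. real (Suc n)) at_top sequentially"
        by (rule filterlim_compose[OF filterlim_real_sequentially filterlim_Suc])
    qed
    ultimately have "summable (\<lambda>n. ((-1) ^ Suc n * \<bar>sin (real (Suc n) * pi * \<alpha>)\<bar>) * f (real (Suc n)))"
      by (rule summable_Dirichlet[OF B])
    then show ?thesis by (simp add: mult_ac del: of_nat_Suc power_Suc)
  qed
  moreover have "D \<in> null_sets lebesgue"
    using D by (rule null_sets_completionI)
  ultimately show ?thesis by blast
qed

end
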